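(* Let $X$ be a path connected compact metric space and $x_0\in X$. If $\pi_1^{qtop}(X,x_0)$ is a regular space, then $\pi_1^{qtop}(X,x_0)$ is normal. In particular, if $\pi_1^{qtop}(X,x_0)$ is $T_3$, then $\pi_1^{qtop}(X,x_0)$ is $T_4$.
   Context: $\Omega(X,x_0)$ denotes the space of loops $[0,1]\to X$ based at $x_0$ with the compact-open topology. $\pi_1^{qtop}(X,x_0)$ is $\pi_1(X,x_0)$ endowed with the quotient topology with respect to the map $\pi:\Omega(X,x_0)\to\pi_1(X,x_0)$, $\pi(\alpha)=[\alpha]$. "Regular" (points can be separated from disjoint closed sets by disjoint open sets) and "normal" (disjoint closed sets can be separated by disjoint open sets) do not include any $T_0$, $T_1$ or $T_2$ assumption. $T_3$ means regular and $T_1$; $T_4$ means normal and $T_2$. *)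

theory Defs
  imports "HOL-Analysis.Analysis"
begin

(* Points of the mapping space are the extensional continuous maps, so that two maps are equal
   iff they agree on topspace X.  The case K = {} of the subbase makes the whole set of maps
   open, so it is the carrier. *)
definition compact_open_topology :: "'a topology \<Rightarrow> 'b topology \<Rightarrow> ('a \<Rightarrow> 'b) topology" where
  "compact_open_topology X Y =
     topology_generated_by
       {{f \<in> extensional (topspace X). continuous_map X Y f \<and> f ` K \<subseteq> U} |K U.
          compactin X K \<and> openin Y U}"

lemma topspace_compact_open_topology:
  "topspace (compact_open_topology X Y) =
     {f \<in> extensional (topspace X). continuous_map X Y f}"
proof -
  let ?C = "{f \<in> extensional (topspace X). continuous_map X Y f}"
  let ?B = "\<lambda>K U. {f \<in> extensional (topspace X). continuous_map X Y f \<and> f ` K \<subseteq> U}"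
  have "?C = ?B {} {}" by simp
  then have "?C \<in> {?B K U |K U. compactin X K \<and> openin Y U}"
    by (intro CollectI exI[of _ "{}"]) auto
  then have "\<Union>{?B K U |K U. compactin X K \<and> openin Y U} = ?C"
    by (intro equalityI Union_least Union_upper) auto
  then show ?thesis
    by (simp add: compact_open_topology_def)
qed

definition loop_space :: "'a topology \<Rightarrow> 'a \<Rightarrow> (real \<Rightarrow> 'a) topology" where
  "loop_space X x0 =
     subtopology (compact_open_topology (top_of_set {0..1}) X) {f. f 0 = x0 \<and> f 1 = x0}"

lemma topspace_loop_space:
  "topspace (loop_space X x0) = {f \<in> extensional {0..1}. pathin X f \<and> f 0 = x0 \<and> f 1 = x0}"
  by (auto simp: loop_space_def topspace_compact_open_topology pathin_def)

definition loop_homotopy :: "'a topology \<Rightarrow> 'a \<Rightarrow> ((real \<Rightarrow> 'a) \<times> (real \<Rightarrow> 'a)) set" where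
  "loop_homotopy X x0 =
     {(f, g). f \<in> topspace (loop_space X x0) \<and> g \<in> topspace (loop_space X x0) \<and>
        homotopic_with (\<lambda>h. h 0 = x0 \<and> h 1 = x0) (top_of_set {0..1}) X f g}"

lemma equiv_loop_homotopy: "equiv (topspace (loop_space X x0)) (loop_homotopy X x0)"
proof (rule equivI)
  show "loop_homotopy X x0 \<subseteq> topspace (loop_space X x0) \<times> topspace (loop_space X x0)"
    by (auto simp: loop_homotopy_def)
  show "refl_on (topspace (loop_space X x0)) (loop_homotopy X x0)"
    by (auto simp: loop_homotopy_def refl_on_def topspace_loop_space pathin_def)
  show "sym (loop_homotopy X x0)"
    unfolding loop_homotopy_def sym_def using homotopic_with_symD by fastforce
  show "trans (loop_homotopy X x0)"
  proof (rule transI)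
    fix f g h
    assume "(f, g) \<in> loop_homotopy X x0" "(g, h) \<in> loop_homotopy X x0"
    then show "(f, h) \<in> loop_homotopy X x0"
      unfolding loop_homotopy_def mem_Collect_eq prod.case by (meson homotopic_with_trans)
  qed
qed

lemma loop_homotopy_iff_homotopic_paths:
  assumes "f \<in> topspace (loop_space (top_of_set S) x0)" "g \<in> topspace (loop_space (top_of_set S) x0)"
  shows "(f, g) \<in> loop_homotopy (top_of_set S) x0 \<longleftrightarrow> homotopic_paths S f g"
  using assms
  by (simp add: loop_homotopy_def homotopic_paths_def topspace_loop_space pathstart_def pathfinish_def)

definition quotient_topology :: "'a topology \<Rightarrow> ('a \<Rightarrow> 'b) \<Rightarrow> 'b topology" where
  "quotient_topology X q =
     topology (\<lambda>U. U \<subseteq> q ` topspace X \<and> openin X {x \<in> topspace X. q x \<in> U})"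

lemma openin_quotient_topology:
  "openin (quotient_topology X q) U \<longleftrightarrow>
     U \<subseteq> q ` topspace X \<and> openin X {x \<in> topspace X. q x \<in> U}"
proof -
  have "istopology (\<lambda>U. U \<subseteq> q ` topspace X \<and> openin X {x \<in> topspace X. q x \<in> U})"
    unfolding istopology_def
  proof (intro conjI allI impI)
    fix S T
    assume "S \<subseteq> q ` topspace X \<and> openin X {x \<in> topspace X. q x \<in> S}"
      and "T \<subseteq> q ` topspace X \<and> openin X {x \<in> topspace X. q x \<in> T}"
    moreover have "{x \<in> topspace X. q x \<in> S \<inter> T}
        = {x \<in> topspace X. q x \<in> S} \<inter> {x \<in> topspace X. q x \<in> T}" by blast
    ultimately show "S \<inter> T \<subseteq> q ` topspace X" "openin X {x \<in> topspace X. q x \<in> S \<inter> T}"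
      by auto
  next
    fix \<K>
    assume \<K>: "\<forall>K\<in>\<K>. K \<subseteq> q ` topspace X \<and> openin X {x \<in> topspace X. q x \<in> K}"
    then show "\<Union>\<K> \<subseteq> q ` topspace X" by blast
    have "{x \<in> topspace X. q x \<in> \<Union>\<K>} = (\<Union>K\<in>\<K>. {x \<in> topspace X. q x \<in> K})" by blast
    then show "openin X {x \<in> topspace X. q x \<in> \<Union>\<K>}"
      using \<K> by auto
  qed
  then show ?thesis
    by (simp add: quotient_topology_def)
qed

lemma topspace_quotient_topology: "topspace (quotient_topology X q) = q ` topspace X"
proof
  show "topspace (quotient_topology X q) \<subseteq> q ` topspace X"
    using openin_topspace[of "quotient_topology X q"] unfolding openin_quotient_topology by (rule conjunct1)
  have "{x \<in> topspace X. q x \<in> q ` topspace X} = topspace X" by blast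
  then have "openin (quotient_topology X q) (q ` topspace X)"
    by (simp add: openin_quotient_topology)
  then show "q ` topspace X \<subseteq> topspace (quotient_topology X q)"
    by (rule openin_subset)
qed

lemma quotient_map_quotient_topology: "quotient_map X (quotient_topology X q) q"
  by (auto simp: quotient_map_def topspace_quotient_topology openin_quotient_topology)

definition pi1_qtop :: "'a topology \<Rightarrow> 'a \<Rightarrow> (real \<Rightarrow> 'a) set topology" where
  "pi1_qtop X x0 = quotient_topology (loop_space X x0) (\<lambda>\<alpha>. loop_homotopy X x0 `` {\<alpha>})"

lemma topspace_pi1_qtop:
  "topspace (pi1_qtop X x0) = topspace (loop_space X x0) // loop_homotopy X x0"
  by (auto simp: pi1_qtop_def topspace_quotient_topology quotient_def)

end

theory Submission
  imports Defs
begin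

text \<open>A compact metric space \<open>X\<close> is second countable, and so is the space of maps from \<open>[0,1]\<close>
  to \<open>X\<close>: a countable subbase of the compact-open topology is given by the sets of maps sending
  \<open>C\<close> into \<open>B\<close>, where \<open>B\<close> is a basic open set of \<open>X\<close> and \<open>C\<close> runs through countably many
  compact sets, one for each pair of basic open sets of \<open>[0,1]\<close> that admits a compact set between
  its members. Hence \<open>\<Omega>(X, x\<^sub>0)\<close> and its quotient are Lindelof, and a regular Lindelof space
  is normal.\<close>

text \<open>Total boundedness gives a finite net for each radius \<open>1 / (n + 1)\<close>; the
  balls of these radii around the net points form a countable base.\<close>

lemma (in Metric_space) mtotally_bounded_imp_second_countable:
  assumes "mtotally_bounded M"
  shows "second_countable mtopology"
proof -
  have "\<exists>K. finite K \<and> K \<subseteq> M \<and> M \<subseteq> (\<Union>x\<in>K. mball x (1 / real (Suc n)))" for n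
    using assms unfolding mtotally_bounded_def by simp
  then obtain K where K: "\<And>n. finite (K n)" "\<And>n. K n \<subseteq> M"
      "\<And>n. M \<subseteq> (\<Union>x\<in>K n. mball x (1 / real (Suc n)))"
    by metis
  let ?B = "\<Union>n. (\<lambda>x. mball x (1 / real (Suc n))) ` K n"
  have "\<exists>V\<in>?B. x \<in> V \<and> V \<subseteq> U" if U: "openin mtopology U" and "x \<in> U" for U x
  proof -
    obtain r where r: "r > 0" "mball x r \<subseteq> U" and "x \<in> M"
      using U \<open>x \<in> U\<close> unfolding openin_mtopology by blast
    \<comment> \<open>Half of \<open>r\<close> is enough: a ball of this radius containing
      \<open>x\<close> has all its points within twice the radius of \<open>x\<close>, hence lies in
      \<open>mball x r\<close>.\<close>
    obtain n where n: "1 / real (Suc n) < r / 2"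
      using reals_Archimedean[of "r / 2"] r by (auto simp: inverse_eq_divide)
    obtain y where y: "y \<in> K n" "x \<in> mball y (1 / real (Suc n))"
      using K(3)[of n] \<open>x \<in> M\<close> by blast
    have "mball y (1 / real (Suc n)) \<subseteq> mball x r"
    proof
      fix z assume z: "z \<in> mball y (1 / real (Suc n))"
      with y have "d x z \<le> d y x + d y z"
        by (metis commute in_mball triangle)
      with y z n show "z \<in> mball x r"
        by auto
    qed
    with y r show ?thesis
      by blast
  qed
  then have "\<forall>U x. openin mtopology U \<and> x \<in> U \<longrightarrow> (\<exists>V\<in>?B. x \<in> V \<and> V \<subseteq> U)"
    by blast
  moreover have "countable ?B"
    by (simp add: K(1) countable_finite)
  moreover have "\<forall>V\<in>?B. openin mtopology V"
    by blast
  ultimately show ?thesis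
    unfolding second_countable_def by (intro exI[of _ ?B] conjI)
qed

text \<open>A compact set squeezed between basic open sets \<open>V\<close> and \<open>W\<close> can
  be exchanged for any other such set without harm, since only \<open>x \<in> V\<close> and
  \<open>W \<subseteq> U\<close> matter. So one choice per pair suffices, and there are countably
  many pairs.\<close>

lemma second_countable_compact_neighbourhoods:
  assumes "second_countable X" and "neighbourhood_base_of (compactin X) X"
  shows "\<exists>\<C>. countable \<C> \<and> (\<forall>C\<in>\<C>. compactin X C) \<and>
    (\<forall>U x. openin X U \<and> x \<in> U \<longrightarrow> (\<exists>V C. openin X V \<and> C \<in> \<C> \<and> x \<in> V \<and> V \<subseteq> C \<and> C \<subseteq> U))"
proof -
  obtain \<B> where \<B>: "countable \<B>" "\<And>V. V \<in> \<B> \<Longrightarrow> openin X V"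
      "\<And>U x. \<lbrakk>openin X U; x \<in> U\<rbrakk> \<Longrightarrow> \<exists>V\<in>\<B>. x \<in> V \<and> V \<subseteq> U"
    using assms(1) unfolding second_countable_def by metis
  define P where "P \<equiv> {(V, W) \<in> \<B> \<times> \<B>. \<exists>C. compactin X C \<and> V \<subseteq> C \<and> C \<subseteq> W}"
  define c where "c \<equiv> \<lambda>(V, W). SOME C. compactin X C \<and> V \<subseteq> C \<and> C \<subseteq> W"
  have c: "compactin X (c (V, W)) \<and> V \<subseteq> c (V, W) \<and> c (V, W) \<subseteq> W" if "(V, W) \<in> P" for V W
  proof -
    have "\<exists>C. compactin X C \<and> V \<subseteq> C \<and> C \<subseteq> W"
      using that by (simp add: P_def)
    then show ?thesis
      unfolding c_def prod.case by (rule someI_ex)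
  qed
  show ?thesis
  proof (intro exI[of _ "c ` P"] conjI ballI allI impI)
    have "countable P"
      by (rule countable_subset[of _ "\<B> \<times> \<B>"]) (auto simp: P_def \<B>(1))
    then show "countable (c ` P)"
      by simp
    show "compactin X C" if "C \<in> c ` P" for C
      using that c by auto
    show "\<exists>V C. openin X V \<and> C \<in> c ` P \<and> x \<in> V \<and> V \<subseteq> C \<and> C \<subseteq> U"
      if "openin X U \<and> x \<in> U" for U x
    proof -
      from that have U: "openin X U" "x \<in> U"
        by auto
      \<comment> \<open>Shrink three times: to a basic \<open>W\<close>, to a compact neighbourhood
        \<open>C\<close> inside \<open>W\<close>, to a basic \<open>V\<close> inside that
        neighbourhood. Then \<open>C\<close> shows that \<open>(V, W)\<close> lies in
        \<open>P\<close>, and \<open>c (V, W)\<close> takes its place.\<close>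
      obtain W where W: "W \<in> \<B>" "x \<in> W" "W \<subseteq> U"
        using \<B>(3) U by blast
      obtain V' C where V': "openin X V'" "compactin X C" "x \<in> V'" "V' \<subseteq> C" "C \<subseteq> W"
        using assms(2) \<B>(2) W unfolding neighbourhood_base_of by meson
      obtain V where V: "V \<in> \<B>" "x \<in> V" "V \<subseteq> V'"
        using \<B>(3) V' by blast
      have P: "(V, W) \<in> P"
        unfolding P_def using V V' W by blast
      show ?thesis
        using c[OF P] P V W \<B>(2) by (intro exI[of _ V] exI[of _ "c (V, W)"]) auto
    qed
  qed
qed

text \<open>The countable base consists of finite intersections of sets \<open>G C B\<close> with
  \<open>C\<close> in \<open>\<C>\<close> and \<open>B\<close> in \<open>\<B>\<close>. Compactness
  of \<open>K\<close> is what fits such an intersection between a map and a subbasic set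
  \<open>G K U\<close>.\<close>

proposition second_countable_compact_open_topology:
  assumes "second_countable X" and "neighbourhood_base_of (compactin X) X"
    and "second_countable Y"
  shows "second_countable (compact_open_topology X Y)"
proof -
  obtain \<C> where \<C>: "countable \<C>" "\<And>C. C \<in> \<C> \<Longrightarrow> compactin X C"
      "\<And>U x. \<lbrakk>openin X U; x \<in> U\<rbrakk> \<Longrightarrow> \<exists>V C. openin X V \<and> C \<in> \<C> \<and> x \<in> V \<and> V \<subseteq> C \<and> C \<subseteq> U"
    using second_countable_compact_neighbourhoods[OF assms(1,2)] by metis
  obtain \<B> where \<B>: "countable \<B>" "\<And>V. V \<in> \<B> \<Longrightarrow> openin Y V"
      "\<And>U x. \<lbrakk>openin Y U; x \<in> U\<rbrakk> \<Longrightarrow> \<exists>V\<in>\<B>. x \<in> V \<and> V \<subseteq> U"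
    using assms(3) unfolding second_countable_def by metis
  define G where "G \<equiv> \<lambda>K U. {f \<in> extensional (topspace X). continuous_map X Y f \<and> f ` K \<subseteq> U}"
  define \<S> where "\<S> \<equiv> {G K U |K U. compactin X K \<and> openin Y U}"
  define T where "T \<equiv> compact_open_topology X Y"
  \<comment> \<open>Meeting with \<open>topspace T\<close> makes the empty family yield the whole
    space instead of the universe of the type.\<close>
  define b where "b \<equiv> \<lambda>\<F>. topspace T \<inter> (\<Inter>(K, U)\<in>\<F>. G K U)"
  define \<A> where "\<A> \<equiv> b ` {\<F>. finite \<F> \<and> \<F> \<subseteq> \<C> \<times> \<B>}"
  have T: "T = topology_generated_by \<S>"
    by (simp add: T_def \<S>_def G_def compact_open_topology_def)
  have topT: "topspace T = {f \<in> extensional (topspace X). continuous_map X Y f}"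
    by (simp add: T_def topspace_compact_open_topology)
  have openG: "openin T (G K U)" if "compactin X K" "openin Y U" for K U
    unfolding T by (rule topology_generated_by_Basis) (use that in \<open>auto simp: \<S>_def\<close>)
  have "countable \<A>"
    unfolding \<A>_def using \<C>(1) \<B>(1) by (intro countable_image countable_Collect_finite_subset) auto
  moreover have "openin T A" if A: "A \<in> \<A>" for A
  proof -
    obtain \<F> where \<F>: "finite \<F>" "\<F> \<subseteq> \<C> \<times> \<B>" "A = b \<F>"
      using A unfolding \<A>_def by blast
    have "openin T S" if "S \<in> (\<lambda>(K, U). G K U) ` \<F>" for S
      using that \<F>(2) \<C>(2) \<B>(2) openG by fastforce
    then show ?thesis
      unfolding \<F>(3) b_def using \<F>(1) by (intro openin_Int_Inter) simp_all
  qed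
  moreover have "\<exists>A\<in>\<A>. f \<in> A \<and> A \<subseteq> W" if "openin T W" "f \<in> W" for W f
  proof -
    \<comment> \<open>Induction on how \<open>W\<close> is generated from the subbase reduces the
      claim to subbasic sets.\<close>
    have "generate_topology_on \<S> W"
      using that unfolding T by (simp add: openin_topology_generated_by_iff)
    then show ?thesis
      using \<open>f \<in> W\<close>
    proof (induction arbitrary: f)
      case Empty
      then show ?case by simp
    next
      case (Int W1 W2)
      then obtain A1 A2 where A: "A1 \<in> \<A>" "f \<in> A1" "A1 \<subseteq> W1" "A2 \<in> \<A>" "f \<in> A2" "A2 \<subseteq> W2"
        by (metis Int_iff)
      then obtain \<F>1 \<F>2 where \<F>: "finite \<F>1" "\<F>1 \<subseteq> \<C> \<times> \<B>" "A1 = b \<F>1"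
          "finite \<F>2" "\<F>2 \<subseteq> \<C> \<times> \<B>" "A2 = b \<F>2"
        unfolding \<A>_def by blast
      have "A1 \<inter> A2 = b (\<F>1 \<union> \<F>2)"
        unfolding \<F>(3,6) b_def by auto
      moreover have "b (\<F>1 \<union> \<F>2) \<in> \<A>"
        unfolding \<A>_def using \<F> by (intro imageI) simp
      ultimately show ?case
        using A by (intro bexI[of _ "A1 \<inter> A2"]) auto
    next
      case (UN \<W>)
      then show ?case by (meson UnionE Union_upper subset_trans)
    next
      case (Basis W)
      then obtain K U where K: "compactin X K" and U: "openin Y U" and W: "W = G K U"
        by (auto simp: \<S>_def)
      have f: "f \<in> topspace T" "continuous_map X Y f" "f ` K \<subseteq> U"
        using Basis(2) by (auto simp: W G_def topT)
      \<comment> \<open>Pick a basic \<open>B\<close> around \<open>f x\<close> inside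
        \<open>U\<close>; by continuity its preimage is open, so a member of \<open>\<C>\<close>
        fits in it around \<open>x\<close>.\<close>
      have "\<exists>V C B. openin X V \<and> C \<in> \<C> \<and> B \<in> \<B> \<and> x \<in> V \<and> V \<subseteq> C \<and> f ` C \<subseteq> B \<and> B \<subseteq> U"
        if x: "x \<in> K" for x
      proof -
        obtain B where B: "B \<in> \<B>" "f x \<in> B" "B \<subseteq> U"
          using \<B>(3) U f(3) x by blast
        have "openin X {z \<in> topspace X. f z \<in> B}"
          using f(2) B(1) \<B>(2) by (simp add: openin_continuous_map_preimage)
        moreover have "x \<in> {z \<in> topspace X. f z \<in> B}"
          using B(2) x compactin_subset_topspace[OF K] by auto
        ultimately obtain V C where "openin X V" "C \<in> \<C>" "x \<in> V" "V \<subseteq> C"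
            "C \<subseteq> {z \<in> topspace X. f z \<in> B}"
          using \<C>(3) by meson
        with B show ?thesis
          by blast
      qed
      then obtain V C B where VCB: "\<And>x. x \<in> K \<Longrightarrow> openin X (V x) \<and> C x \<in> \<C> \<and> B x \<in> \<B> \<and>
          x \<in> V x \<and> V x \<subseteq> C x \<and> f ` C x \<subseteq> B x \<and> B x \<subseteq> U"
        by metis
      have "\<exists>L. finite L \<and> L \<subseteq> K \<and> K \<subseteq> \<Union>(V ` L)"
      proof -
        have "\<exists>\<F>. finite \<F> \<and> \<F> \<subseteq> V ` K \<and> K \<subseteq> \<Union>\<F>"
          using K VCB by (intro compactinD) auto
        then show ?thesis
          by (metis finite_subset_image)
      qed
      then obtain L where L: "finite L" "L \<subseteq> K" "K \<subseteq> \<Union>(V ` L)"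
        by blast
      \<comment> \<open>The finitely many \<open>V x\<close> with \<open>x \<in> L\<close> cover
        \<open>K\<close>, hence so do the \<open>C x\<close>. A map sending each of these
        \<open>C x\<close> into \<open>B x\<close> therefore sends \<open>K\<close> into
        \<open>U\<close>.\<close>
      let ?A = "b ((\<lambda>x. (C x, B x)) ` L)"
      have "?A \<in> \<A>"
        unfolding \<A>_def using L VCB by (intro imageI) auto
      moreover have "f ` C x \<subseteq> B x" if "x \<in> L" for x
        using VCB L(2) that by blast
      then have "f \<in> ?A"
        using f(1) by (auto simp: b_def G_def topT)
      moreover have "?A \<subseteq> W"
      proof
        fix g assume g: "g \<in> ?A"
        have "g y \<in> U" if y: "y \<in> K" for y
        proof -
          obtain x where "x \<in> L" "y \<in> V x"
            using L y by blast
          then have "x \<in> K" "g ` C x \<subseteq> B x"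
            using g L(2) by (auto simp: b_def G_def)
          with VCB[of x] \<open>y \<in> V x\<close> show ?thesis
            by blast
        qed
        with g show "g \<in> W"
          by (auto simp: W b_def G_def topT)
      qed
      ultimately show ?case
        by blast
    qed
  qed
  ultimately show ?thesis
    unfolding second_countable_def T_def[symmetric] by blast
qed

lemma second_countable_top_of_set:
  fixes S :: "'a::second_countable_topology set"
  shows "second_countable (top_of_set S)"
proof -
  obtain \<B> :: "'a set set" where "countable \<B>" "\<And>C. C \<in> \<B> \<Longrightarrow> open C"
      "\<And>U. open U \<Longrightarrow> \<exists>\<U>. \<U> \<subseteq> \<B> \<and> U = \<Union>\<U>"
    using univ_second_countable by blast
  then have "second_countable (euclidean :: 'a topology)"
    unfolding second_countable_def by (intro exI[of _ \<B>]) (simp, blast)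
  then show ?thesis
    by (rule second_countable_subtopology)
qed

text \<open>Second countability can be lost in a quotient, but the Lindelof property that it implies
  passes along quotient maps.\<close>

lemma Lindelof_space_pi1_qtop:
  assumes "second_countable X"
  shows "Lindelof_space (pi1_qtop X x0)"
proof -
  \<comment> \<open>A compact Hausdorff space is locally compact in the strong sense: compact
    neighbourhoods form a base at each point.\<close>
  have "compact_space (top_of_set {0..1::real})" "Hausdorff_space (top_of_set {0..1::real})"
    by (auto simp: compact_space_subtopology Hausdorff_space_subtopology)
  then have "neighbourhood_base_of (compactin (top_of_set {0..1::real})) (top_of_set {0..1})"
    using locally_compact_space_neighbourhood_base compact_imp_locally_compact_space by blast
  then have "second_countable (loop_space X x0)"
    unfolding loop_space_def using assms
    by (intro second_countable_subtopology second_countable_compact_open_topology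
        second_countable_top_of_set)
  then show ?thesis
    unfolding pi1_qtop_def
    using Lindelof_space_quotient_map_image quotient_map_quotient_topology
      second_countable_imp_Lindelof_space by blast
qed

theorem theorem34:
  fixes M :: "'a set" and d :: "'a \<Rightarrow> 'a \<Rightarrow> real" and x0 :: 'a
  assumes "Metric_space M d"
    and "compact_space (Metric_space.mtopology M d)"
    and "path_connected_space (Metric_space.mtopology M d)"
    and "x0 \<in> M"
  shows "(regular_space (pi1_qtop (Metric_space.mtopology M d) x0) \<longrightarrow>
            normal_space (pi1_qtop (Metric_space.mtopology M d) x0)) \<and>
         (regular_space (pi1_qtop (Metric_space.mtopology M d) x0) \<and>
          t1_space (pi1_qtop (Metric_space.mtopology M d) x0) \<longrightarrow>
            normal_space (pi1_qtop (Metric_space.mtopology M d) x0) \<and>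
            Hausdorff_space (pi1_qtop (Metric_space.mtopology M d) x0))"
proof -
  interpret Metric_space M d
    by fact
  have "mtotally_bounded M"
    using assms(2) compactin_imp_mtotally_bounded by (simp add: compact_space_def)
  then have "Lindelof_space (pi1_qtop mtopology x0)"
    by (intro Lindelof_space_pi1_qtop mtotally_bounded_imp_second_countable)
  \<comment> \<open>Regular Lindelof spaces are normal. For the second claim, regularity and T1
    together also give the Hausdorff half of T4.\<close>
  then show ?thesis
    using regular_Lindelof_imp_normal_space regular_t1_imp_Hausdorff_space by blast
qed

end
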